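(* Let $\Omega \subset \mathbb{R}^2$ be a bounded open region, let $m,n$ be nonnegative integers, and let $f(x,y) \in C^{m+n}(\Omega)$ and $u(x,y) \in C^{m+n}(\Omega)$. Then in the region $\Omega$ it holds that $$f(x,y)\frac{\partial^{m+n}u(x,y)}{\partial x^m \partial y^n}=\sum_{i=0}^{m}\sum_{j=0}^{n}(-1)^{i+j}\binom{m}{i}\binom{n}{j}\frac{\partial^{(m-i)+(n-j)}}{\partial x^{m-i} \partial y^{n-j}}\left[\frac{\partial^{i+j}f(x,y)}{\partial x^i \partial y^j}\,u(x,y)\right].$$
   Context: Functions are real-valued, and $C^{k}(\Omega)$ denotes the $k$ times continuously differentiable functions on $\Omega$. Derivatives of order zero in a variable are defined by $$\frac{\partial^{m+0}g(x,y)}{\partial x^m \partial y^0}:=\frac{\partial^m g(x,y)}{\partial x^m},\quad \frac{\partial^{0+n}g(x,y)}{\partial x^0 \partial y^n}:=\frac{\partial^n g(x,y)}{\partial y^n},\quad \frac{\partial^{0+0}g(x,y)}{\partial x^0 \partial y^0}:= g(x,y).$$ *)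

theory Defs
  imports "HOL-Analysis.Analysis"
begin

definition partial_x :: "(real \<times> real \<Rightarrow> real) \<Rightarrow> real \<times> real \<Rightarrow> real" where
  "partial_x g = (\<lambda>(x, y). deriv (\<lambda>t. g (t, y)) x)"

definition partial_y :: "(real \<times> real \<Rightarrow> real) \<Rightarrow> real \<times> real \<Rightarrow> real" where
  "partial_y g = (\<lambda>(x, y). deriv (\<lambda>t. g (x, t)) y)"

text \<open>
  The \<open>y\<close>-derivatives are taken first, as in the usual reading of
  \<open>\<partial>\<^sup>m\<^sup>+\<^sup>n g / \<partial>x\<^sup>m \<partial>y\<^sup>n\<close>. An exponent \<open>0\<close> means no differentiation in that variable.
\<close>
definition mixed_partial ::
    "nat \<Rightarrow> nat \<Rightarrow> (real \<times> real \<Rightarrow> real) \<Rightarrow> real \<times> real \<Rightarrow> real" where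
  "mixed_partial m n g = (partial_x ^^ m) ((partial_y ^^ n) g)"

text \<open>
  \<open>C_diff k S g\<close>: all iterated partial derivatives of \<open>g\<close> of order at most \<open>k\<close>, taken in any
  order of the variables, exist and are continuous on \<open>S\<close>. Meant for open \<open>S\<close>: then
  the partial derivatives at points of \<open>S\<close> depend only on the values of \<open>g\<close> on \<open>S\<close>, so it is
  harmless that \<open>g\<close> is a total function. Existence has to be required separately because
  \<^const>\<open>deriv\<close> is total.
\<close>
primrec C_diff :: "nat \<Rightarrow> (real \<times> real) set \<Rightarrow> (real \<times> real \<Rightarrow> real) \<Rightarrow> bool" where
  "C_diff 0 S g \<longleftrightarrow> continuous_on S g"
| "C_diff (Suc k) S g \<longleftrightarrow>
     continuous_on S g \<and>
     (\<forall>(x, y) \<in> S. (\<lambda>t. g (t, y)) differentiable (at x) \<and>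
                   (\<lambda>t. g (x, t)) differentiable (at y)) \<and>
     C_diff k S (partial_x g) \<and> C_diff k S (partial_y g)"

end

theory Submission
  imports Defs
begin

text \<open>
  In one variable, the identity
  \<open>f \<cdot> D\<^sup>n v = (\<Sum>j\<le>n. (-1)\<^sup>j (n choose j) D\<^sup>n\<^sup>-\<^sup>j (D\<^sup>j f \<cdot> v))\<close> is the Leibniz rule read backwards. It
  follows by induction on \<open>n\<close>: replacing \<open>v\<close> by \<open>D v\<close> and using
  \<open>D\<^sup>j f \<cdot> D v = D (D\<^sup>j f \<cdot> v) - D\<^sup>j\<^sup>+\<^sup>1 f \<cdot> v\<close>, each term splits into two neighbouring terms, and
  these recombine by Pascal's rule. This argument is purely algebraic, so it is carried out once, in
  \<open>times_iterated_derivative\<close>, for any operator obeying the rules of a derivation, and then used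
  for both partial derivatives.

  For two variables, the identity in \<open>x\<close> is applied to \<open>f\<close> and \<open>\<partial>\<^sub>y\<^sup>n u\<close>, and then, inside each
  \<open>x\<close>-derivative, the identity in \<open>y\<close> is applied to \<open>\<partial>\<^sub>x\<^sup>i f\<close> and \<open>u\<close>. This yields derivatives
  \<open>\<partial>\<^sub>y\<^sup>j \<partial>\<^sub>x\<^sup>i f\<close>, whereas the theorem has \<open>\<partial>\<^sub>x\<^sup>i \<partial>\<^sub>y\<^sup>j f\<close>; the two agree by Schwarz's theorem
  (\<open>partial_y_partial_x\<close>), which is proved by applying the mean value theorem in each
  variable to a second-order difference over a small square.
\<close>

section \<open>Functions with continuous partial derivatives\<close>

lemma C_diff_SucD: "C_diff (Suc k) S g \<Longrightarrow> C_diff k S g"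
proof (induction k arbitrary: g)
  case (Suc k)
  then show ?case
    unfolding C_diff.simps(2)[of "Suc k"] C_diff.simps(2)[of k S g] by blast
qed simp

lemma C_diff_mono:
  assumes "C_diff l S g" "k \<le> l"
  shows "C_diff k S g"
  using assms(2,1) by (induction rule: dec_induct) (blast dest: C_diff_SucD)+

lemma C_diff_imp_continuous_on: "C_diff k S g \<Longrightarrow> continuous_on S g"
  by (cases k) auto

lemma has_real_derivative_partial_x:
  assumes "C_diff (Suc k) S g" "(x, y) \<in> S"
  shows "((\<lambda>t. g (t, y)) has_real_derivative partial_x g (x, y)) (at x)"
  using assms by (auto simp: partial_x_def DERIV_deriv_iff_real_differentiable)

lemma has_real_derivative_partial_y:
  assumes "C_diff (Suc k) S g" "(x, y) \<in> S"
  shows "((\<lambda>t. g (x, t)) has_real_derivative partial_y g (x, y)) (at y)"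
  using assms by (auto simp: partial_y_def DERIV_deriv_iff_real_differentiable)

lemma partial_x_eqI:
  "((\<lambda>t. g (t, y)) has_real_derivative d) (at x) \<Longrightarrow> partial_x g (x, y) = d"
  by (simp add: partial_x_def DERIV_imp_deriv)

lemma partial_y_eqI:
  "((\<lambda>t. g (x, t)) has_real_derivative d) (at y) \<Longrightarrow> partial_y g (x, y) = d"
  by (simp add: partial_y_def DERIV_imp_deriv)

lemma eventually_horizontal_in_open:
  assumes "open (S :: (real \<times> real) set)" "(x, y) \<in> S"
  shows "\<forall>\<^sub>F t in nhds x. (t, y) \<in> S"
proof -
  have "open ((\<lambda>t. (t, y)) -` S)"
    using assms(1) by (intro open_vimage continuous_intros)
  then show ?thesis
    using eventually_nhds_in_open assms(2) by force
qed

lemma eventually_vertical_in_open: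
  assumes "open (S :: (real \<times> real) set)" "(x, y) \<in> S"
  shows "\<forall>\<^sub>F t in nhds y. (x, t) \<in> S"
proof -
  have "open ((\<lambda>t. (x, t)) -` S)"
    using assms(1) by (intro open_vimage continuous_intros)
  then show ?thesis
    using eventually_nhds_in_open assms(2) by force
qed

lemma partial_x_cong:
  assumes "open S" "\<And>p. p \<in> S \<Longrightarrow> g p = h p" "p \<in> S"
  shows "partial_x g p = partial_x h p"
proof -
  obtain x y where p: "p = (x, y)" by fastforce
  have "\<forall>\<^sub>F t in nhds x. g (t, y) = h (t, y)"
    using eventually_horizontal_in_open[of S x y] assms p by (auto elim: eventually_mono)
  then show ?thesis
    by (simp add: p partial_x_def deriv_cong_ev)
qed

lemma partial_y_cong:
  assumes "open S" "\<And>p. p \<in> S \<Longrightarrow> g p = h p" "p \<in> S"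
  shows "partial_y g p = partial_y h p"
proof -
  obtain x y where p: "p = (x, y)" by fastforce
  have "\<forall>\<^sub>F t in nhds y. g (x, t) = h (x, t)"
    using eventually_vertical_in_open[of S x y] assms p by (auto elim: eventually_mono)
  then show ?thesis
    by (simp add: p partial_y_def deriv_cong_ev)
qed

text \<open>
  The sum and product rules describe a partial derivative on \<open>S\<close> only. Invariance under equality on
  \<open>S\<close> allows the inductions on \<open>k\<close> for sums and products to replace the derivative by the
  expression that these rules give.
\<close>
lemma C_diff_cong:
  assumes "open S" "C_diff k S g" "\<And>p. p \<in> S \<Longrightarrow> g p = h p"
  shows "C_diff k S h"
  using assms(2,3)
proof (induction k arbitrary: g h)
  case 0
  then show ?case
    using continuous_on_cong[of S S g h] by simp
next
  case (Suc k)
  have "C_diff k S (partial_x h)"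
    by (rule Suc.IH[of "partial_x g"])
      (use Suc.prems in \<open>auto intro: partial_x_cong[OF assms(1)]\<close>)
  moreover have "C_diff k S (partial_y h)"
    by (rule Suc.IH[of "partial_y g"])
      (use Suc.prems in \<open>auto intro: partial_y_cong[OF assms(1)]\<close>)
  moreover have "continuous_on S h"
    using Suc.prems continuous_on_cong[of S S g h] by simp
  moreover have "(\<lambda>t. h (t, y)) differentiable (at x) \<and> (\<lambda>t. h (x, t)) differentiable (at y)"
    if "(x, y) \<in> S" for x y
  proof -
    have "\<forall>\<^sub>F t in nhds x. g (t, y) = h (t, y)" "\<forall>\<^sub>F t in nhds y. g (x, t) = h (x, t)"
      using eventually_horizontal_in_open[OF assms(1) that]
        eventually_vertical_in_open[OF assms(1) that] Suc.prems(2)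
      by (auto elim: eventually_mono)
    then have "((\<lambda>t. h (t, y)) has_real_derivative partial_x g (x, y)) (at x)"
      "((\<lambda>t. h (x, t)) has_real_derivative partial_y g (x, y)) (at y)"
      using has_real_derivative_partial_x[OF Suc.prems(1) that]
        has_real_derivative_partial_y[OF Suc.prems(1) that]
      by (auto simp: DERIV_cong_ev)
    then show ?thesis
      by (auto simp: real_differentiable_def)
  qed
  ultimately show ?case by auto
qed

lemma C_diff_const: "C_diff k S (\<lambda>_. c)"
proof (induction k arbitrary: c)
  case (Suc k)
  then show ?case
    by (simp add: partial_x_def partial_y_def case_prod_unfold)
qed simp

lemma partial_add:
  assumes "C_diff (Suc k) S g" "C_diff (Suc k) S h" "p \<in> S"
  shows partial_x_add: "partial_x (\<lambda>q. g q + h q) p = partial_x g p + partial_x h p"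
    and partial_y_add: "partial_y (\<lambda>q. g q + h q) p = partial_y g p + partial_y h p"
  using assms
  by (cases p; auto intro!: partial_x_eqI partial_y_eqI derivative_eq_intros
      has_real_derivative_partial_x has_real_derivative_partial_y simp del: C_diff.simps)+

lemma partial_mult:
  assumes "C_diff (Suc k) S g" "C_diff (Suc k) S h" "p \<in> S"
  shows partial_x_mult:
      "partial_x (\<lambda>q. g q * h q) p = partial_x g p * h p + g p * partial_x h p"
    and partial_y_mult:
      "partial_y (\<lambda>q. g q * h q) p = partial_y g p * h p + g p * partial_y h p"
  using assms
  by (cases p; auto intro!: partial_x_eqI partial_y_eqI derivative_eq_intros
      has_real_derivative_partial_x has_real_derivative_partial_y simp del: C_diff.simps)+

lemma C_diff_add:
  assumes "open S" "C_diff k S g" "C_diff k S h"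
  shows "C_diff k S (\<lambda>p. g p + h p)"
  using assms(2,3)
proof (induction k arbitrary: g h)
  case 0
  then show ?case by (auto intro: continuous_intros)
next
  case (Suc k)
  have "C_diff k S (partial_x (\<lambda>p. g p + h p))"
    by (rule C_diff_cong[OF assms(1) Suc.IH[of "partial_x g" "partial_x h"]])
      (use Suc.prems in \<open>auto simp: partial_x_add[OF Suc.prems]\<close>)
  moreover have "C_diff k S (partial_y (\<lambda>p. g p + h p))"
    by (rule C_diff_cong[OF assms(1) Suc.IH[of "partial_y g" "partial_y h"]])
      (use Suc.prems in \<open>auto simp: partial_y_add[OF Suc.prems]\<close>)
  ultimately show ?case
    using Suc.prems by (auto intro!: continuous_intros derivative_intros)
qed

lemma C_diff_mult:
  assumes "open S" "C_diff k S g" "C_diff k S h"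
  shows "C_diff k S (\<lambda>p. g p * h p)"
  using assms(2,3)
proof (induction k arbitrary: g h)
  case 0
  then show ?case by (auto intro: continuous_intros)
next
  case (Suc k)
  note lower = Suc.prems[THEN C_diff_SucD]
  have "C_diff k S (\<lambda>p. partial_x g p * h p + g p * partial_x h p)"
    using Suc.prems lower by (auto intro!: C_diff_add[OF assms(1)] Suc.IH)
  then have x: "C_diff k S (partial_x (\<lambda>p. g p * h p))"
    by (rule C_diff_cong[OF assms(1)]) (simp add: partial_x_mult[OF Suc.prems])
  have "C_diff k S (\<lambda>p. partial_y g p * h p + g p * partial_y h p)"
    using Suc.prems lower by (auto intro!: C_diff_add[OF assms(1)] Suc.IH)
  then have y: "C_diff k S (partial_y (\<lambda>p. g p * h p))"
    by (rule C_diff_cong[OF assms(1)]) (simp add: partial_y_mult[OF Suc.prems])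
  show ?case
    using x y Suc.prems by (auto intro!: continuous_intros derivative_intros)
qed

lemma C_diff_sum:
  assumes "open S" "\<And>i. i \<in> A \<Longrightarrow> C_diff k S (g i)"
  shows "C_diff k S (\<lambda>p. \<Sum>i\<in>A. g i p)"
  using assms(2)
  by (induction A rule: infinite_finite_induct)
    (auto intro: C_diff_const C_diff_add[OF assms(1)])

lemma C_diff_partial_x: "C_diff (Suc k) S g \<Longrightarrow> C_diff k S (partial_x g)"
  and C_diff_partial_y: "C_diff (Suc k) S g \<Longrightarrow> C_diff k S (partial_y g)"
  by simp_all

(* Unfolding the successor case would turn regularity hypotheses into conjunctions of conditions on
   derivatives, to which the lemmas about C_diff no longer apply. *)
declare C_diff.simps(2) [simp del]

section \<open>Reversing the Leibniz rule for a single derivation\<close>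

text \<open>
  The two partial derivatives share everything that the one-variable identity depends on. The rule
  \<open>D_cong\<close> is part of the interface because the functions are total while the other rules speak
  about points of \<open>S\<close> only: rewriting underneath a further \<open>D\<close> must be possible from
  equality on \<open>S\<close>.
\<close>
locale derivation_on =
  fixes S :: "(real \<times> real) set"
    and D :: "(real \<times> real \<Rightarrow> real) \<Rightarrow> real \<times> real \<Rightarrow> real"
  assumes open_S: "open S"
    and C_diff_D: "C_diff (Suc k) S g \<Longrightarrow> C_diff k S (D g)"
    and D_cong: "(\<And>q. q \<in> S \<Longrightarrow> g q = h q) \<Longrightarrow> p \<in> S \<Longrightarrow> D g p = D h p"
    and D_const: "p \<in> S \<Longrightarrow> D (\<lambda>_. c) p = 0"
    and D_add: "C_diff (Suc 0) S g \<Longrightarrow> C_diff (Suc 0) S h \<Longrightarrow> p \<in> S \<Longrightarrow>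
      D (\<lambda>q. g q + h q) p = D g p + D h p"
    and D_mult: "C_diff (Suc 0) S g \<Longrightarrow> C_diff (Suc 0) S h \<Longrightarrow> p \<in> S \<Longrightarrow>
      D (\<lambda>q. g q * h q) p = D g p * h p + g p * D h p"
begin

lemma C_diff_funpow: "C_diff (k + n) S g \<Longrightarrow> C_diff k S ((D ^^ n) g)"
proof (induction n arbitrary: k)
  case (Suc n)
  then have "C_diff (Suc k) S ((D ^^ n) g)" by simp
  then show ?case by (simp add: C_diff_D)
qed simp

lemma funpow_cong:
  assumes "\<And>q. q \<in> S \<Longrightarrow> g q = h q" "p \<in> S"
  shows "(D ^^ n) g p = (D ^^ n) h p"
  using assms(2) by (induction n arbitrary: p) (auto simp: assms(1) intro: D_cong)

lemma funpow_add:
  assumes "C_diff n S g" "C_diff n S h" "p \<in> S"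
  shows "(D ^^ n) (\<lambda>q. g q + h q) p = (D ^^ n) g p + (D ^^ n) h p"
  using assms
proof (induction n arbitrary: g h)
  case (Suc n)
  have 1: "C_diff (Suc 0) S g" "C_diff (Suc 0) S h"
    using Suc.prems by (auto intro: C_diff_mono)
  have "(D ^^ Suc n) (\<lambda>q. g q + h q) p = (D ^^ n) (\<lambda>q. D g q + D h q) p"
    unfolding funpow_Suc_right comp_def
    by (rule funpow_cong) (use D_add 1 Suc.prems in auto)
  then show ?case
    using Suc.IH[of "D g" "D h"] Suc.prems C_diff_D by (simp add: funpow_swap1)
qed simp

lemma funpow_cmult:
  assumes "C_diff n S g" "p \<in> S"
  shows "(D ^^ n) (\<lambda>q. c * g q) p = c * (D ^^ n) g p"
  using assms
proof (induction n arbitrary: g)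
  case (Suc n)
  have 1: "C_diff (Suc 0) S g"
    using Suc.prems by (auto intro: C_diff_mono)
  have "D (\<lambda>q. c * g q) q = c * D g q" if "q \<in> S" for q
    using D_mult[OF C_diff_const 1 that, of c] D_const[OF that] by simp
  then have "(D ^^ Suc n) (\<lambda>q. c * g q) p = (D ^^ n) (\<lambda>q. c * D g q) p"
    unfolding funpow_Suc_right comp_def by (rule funpow_cong) (use Suc.prems in auto)
  then show ?case
    using Suc.IH[of "D g"] Suc.prems C_diff_D by (simp add: funpow_swap1)
qed simp

lemma funpow_sum:
  assumes "finite A" "\<And>i. i \<in> A \<Longrightarrow> C_diff n S (g i)" "p \<in> S"
  shows "(D ^^ n) (\<lambda>q. \<Sum>i\<in>A. c i * g i q) p = (\<Sum>i\<in>A. c i * (D ^^ n) (g i) p)"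
  using assms(1,2)
proof (induction A)
  case empty
  then show ?case
    using funpow_cmult[OF C_diff_const assms(3), of n 0 0] by simp
next
  case (insert a A)
  then show ?case
    by (simp add: funpow_add funpow_cmult C_diff_sum C_diff_mult C_diff_const open_S assms(3))
qed

end

text \<open>
  Pascal's rule splits each coefficient of order \<open>n + 1\<close> in two; shifting the index in one of the two
  resulting sums produces the differences. This closes the induction in the identity below.
\<close>
lemma alternating_binomial_sum_Suc:
  fixes t :: "nat \<Rightarrow> real"
  shows "(\<Sum>j\<le>Suc n. (-1) ^ j * real (Suc n choose j) * t j) =
    (\<Sum>j\<le>n. (-1) ^ j * real (n choose j) * (t j - t (Suc j)))"
proof -
  have "(\<Sum>j\<le>Suc n. (-1) ^ j * real (Suc n choose j) * t j) =
      (t 0 + (\<Sum>j\<le>n. (-1) ^ Suc j * real (n choose Suc j) * t (Suc j)))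
      - (\<Sum>j\<le>n. (-1) ^ j * real (n choose j) * t (Suc j))"
    by (subst sum.atMost_Suc_shift) (simp add: algebra_simps sum.distrib sum_negf sum_subtractf)
  also have "t 0 + (\<Sum>j\<le>n. (-1) ^ Suc j * real (n choose Suc j) * t (Suc j)) =
      (\<Sum>j\<le>Suc n. (-1) ^ j * real (n choose j) * t j)"
    by (subst sum.atMost_Suc_shift) simp
  also have "\<dots> = (\<Sum>j\<le>n. (-1) ^ j * real (n choose j) * t j)"
    by simp
  finally show ?thesis
    by (simp add: right_diff_distrib sum_subtractf)
qed

context derivation_on
begin

text \<open>
  The induction hypothesis is used with \<open>D v\<close> in place of \<open>v\<close>. In every term at
  most \<open>n\<close> derivatives fall on \<open>f\<close> and at most \<open>n\<close> on \<open>v\<close>, so \<open>C\<^sup>n\<close> is enough for both.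
\<close>
lemma times_iterated_derivative:
  assumes "C_diff n S f" "C_diff n S v" "p \<in> S"
  shows "f p * (D ^^ n) v p =
    (\<Sum>j\<le>n. (-1) ^ j * real (n choose j) * (D ^^ (n - j)) (\<lambda>q. (D ^^ j) f q * v q) p)"
  using assms
proof (induction n arbitrary: v)
  case (Suc n)
  define T where "T j = (D ^^ (Suc n - j)) (\<lambda>q. (D ^^ j) f q * v q) p" for j
  have split: "(D ^^ (n - j)) (\<lambda>q. (D ^^ j) f q * D v q) p = T j - T (Suc j)" if "j \<le> n" for j
  proof -
    have Dj: "C_diff (Suc (n - j)) S ((D ^^ j) f)"
      using Suc.prems(1) that by (intro C_diff_funpow) simp
    have DSj: "C_diff (n - j) S ((D ^^ Suc j) f)"
      using C_diff_D[OF Dj] by simp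
    have v: "C_diff (Suc (n - j)) S v"
      using Suc.prems(2) by (rule C_diff_mono) simp
    have "T j = (D ^^ (n - j)) (D (\<lambda>q. (D ^^ j) f q * v q)) p"
      using that by (simp add: T_def Suc_diff_le funpow_swap1)
    also have "\<dots> = (D ^^ (n - j)) (\<lambda>q. (D ^^ Suc j) f q * v q + (D ^^ j) f q * D v q) p"
      using Dj v by (intro funpow_cong) (auto simp: D_mult C_diff_mono Suc.prems(3))
    also have "\<dots> = T (Suc j) + (D ^^ (n - j)) (\<lambda>q. (D ^^ j) f q * D v q) p"
      using DSj Dj[THEN C_diff_SucD] v[THEN C_diff_SucD] C_diff_D[OF v] Suc.prems(3)
      by (subst funpow_add) (auto intro: C_diff_mult[OF open_S] simp: T_def)
    finally show ?thesis by simp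
  qed
  have "f p * (D ^^ Suc n) v p = f p * (D ^^ n) (D v) p"
    by (simp add: funpow_swap1)
  also have "\<dots> = (\<Sum>j\<le>n. (-1) ^ j * real (n choose j) *
      (D ^^ (n - j)) (\<lambda>q. (D ^^ j) f q * D v q) p)"
    using Suc.prems C_diff_SucD C_diff_D by (intro Suc.IH)
  also have "\<dots> = (\<Sum>j\<le>n. (-1) ^ j * real (n choose j) * (T j - T (Suc j)))"
    by (intro sum.cong) (auto simp: split)
  also have "\<dots> = (\<Sum>j\<le>Suc n. (-1) ^ j * real (Suc n choose j) * T j)"
    by (rule alternating_binomial_sum_Suc[symmetric])
  finally show ?case by (simp only: T_def)
qed simp

end

lemma derivation_on_partial_x:
  assumes "open S"
  shows "derivation_on S partial_x"
proof
  show "open S" by fact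
  show "partial_x (\<lambda>_. c) p = 0" for c p
    by (cases p) (simp add: partial_x_def)
qed (rule C_diff_partial_x partial_x_cong partial_x_add partial_x_mult; (assumption | rule assms | blast))+

lemma derivation_on_partial_y:
  assumes "open S"
  shows "derivation_on S partial_y"
proof
  show "open S" by fact
  show "partial_y (\<lambda>_. c) p = 0" for c p
    by (cases p) (simp add: partial_y_def)
qed (rule C_diff_partial_y partial_y_cong partial_y_add partial_y_mult; (assumption | rule assms | blast))+

section \<open>Symmetry of mixed partial derivatives\<close>

text \<open>
  The mean value theorem is applied first in \<open>x\<close>, to the increment
  \<open>t \<mapsto> g t (b + h) - g t b\<close>, and then in \<open>y\<close>, to \<open>g\<^sub>x\<close> at the intermediate point. The second
  difference is symmetric in the two variables, so exchanging the arguments of \<open>g\<close> gives the same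
  quantity as a value of \<open>g\<^sub>y\<^sub>x\<close>.
\<close>
lemma second_difference_mean_value:
  fixes g gx gxy :: "real \<Rightarrow> real \<Rightarrow> real"
  assumes h: "h > 0"
    and gx: "\<And>x y. x \<in> {a..a + h} \<Longrightarrow> y \<in> {b..b + h} \<Longrightarrow>
      ((\<lambda>t. g t y) has_real_derivative gx x y) (at x)"
    and gxy: "\<And>x y. x \<in> {a..a + h} \<Longrightarrow> y \<in> {b..b + h} \<Longrightarrow>
      ((\<lambda>t. gx x t) has_real_derivative gxy x y) (at y)"
  obtains x y where "x \<in> {a..a + h}" "y \<in> {b..b + h}"
    "g (a + h) (b + h) - g (a + h) b - g a (b + h) + g a b = h * h * gxy x y"
proof -
  have "((\<lambda>t. g t (b + h) - g t b) has_real_derivative gx x (b + h) - gx x b) (at x)"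
    if "a \<le> x" "x \<le> a + h" for x
    using that h by (intro derivative_intros gx) auto
  then obtain x where x: "a < x" "x < a + h"
    "(g (a + h) (b + h) - g (a + h) b) - (g a (b + h) - g a b) =
      (a + h - a) * (gx x (b + h) - gx x b)"
    using MVT2[of a "a + h" "\<lambda>t. g t (b + h) - g t b" "\<lambda>t. gx t (b + h) - gx t b"] h
    by fastforce
  obtain y where y: "b < y" "y < b + h" "gx x (b + h) - gx x b = (b + h - b) * gxy x y"
    using MVT2[of b "b + h" "gx x" "gxy x"] gxy[of x] h x by fastforce
  show thesis
    using that[of x y] x y by (simp add: algebra_simps)
qed

text \<open>
  If the two mixed derivatives differed at \<open>p\<close>, continuity would keep their ranges on a small square
  at \<open>p\<close> disjoint. But the second difference over that square is, up to the factor \<open>h\<^sup>2\<close>, a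
  value of each of them.
\<close>
lemma partial_y_partial_x:
  assumes "open S" "C_diff (Suc (Suc k)) S g" "p \<in> S"
  shows "partial_y (partial_x g) p = partial_x (partial_y g) p"
proof (rule ccontr)
  let ?A = "partial_y (partial_x g)" and ?B = "partial_x (partial_y g)"
  assume neq: "?A p \<noteq> ?B p"
  define e where "e = \<bar>?A p - ?B p\<bar> / 2"
  have e: "e > 0" using neq by (simp add: e_def)
  obtain a b where p: "p = (a, b)" by fastforce
  have gx: "C_diff (Suc k) S (partial_x g)" and gy: "C_diff (Suc k) S (partial_y g)"
    using assms(2) C_diff_partial_x C_diff_partial_y by blast+
  have "continuous_on S ?A" "continuous_on S ?B"
    using C_diff_imp_continuous_on[OF C_diff_partial_y[OF gx]]
      C_diff_imp_continuous_on[OF C_diff_partial_x[OF gy]] by blast+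
  then have "isCont ?A p" "isCont ?B p"
    using assms(1,3) continuous_on_eq_continuous_at by blast+
  then have "\<forall>\<^sub>F q in nhds p. dist (?A q) (?A p) < e" "\<forall>\<^sub>F q in nhds p. dist (?B q) (?B p) < e"
    using e unfolding continuous_at_eps_delta eventually_nhds_metric by blast+
  moreover have "\<forall>\<^sub>F q in nhds p. q \<in> S"
    using assms(1,3) by (simp add: eventually_nhds_in_open)
  ultimately have "\<forall>\<^sub>F q in nhds p. q \<in> S \<and> dist (?A q) (?A p) < e \<and> dist (?B q) (?B p) < e"
    by eventually_elim simp
  then obtain d where d: "d > 0"
    and near: "\<And>q. dist q p < d \<Longrightarrow> q \<in> S \<and> dist (?A q) (?A p) < e \<and> dist (?B q) (?B p) < e"
    unfolding eventually_nhds_metric by blast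
  define h where "h = d / 3"
  have h: "h > 0" using d by (simp add: h_def)
  have square: "dist (x, y) p < d" if "x \<in> {a..a + h}" "y \<in> {b..b + h}" for x y
  proof -
    have "dist (x, y) p \<le> \<bar>x - a\<bar> + \<bar>y - b\<bar>"
      using sqrt_sum_squares_le_sum_abs[of "x - a" "y - b"]
      by (simp add: p dist_Pair_Pair dist_real_def)
    then show ?thesis using that d by (simp add: h_def)
  qed
  note in_S = near[OF square, THEN conjunct1]
  obtain x y where xy: "x \<in> {a..a + h}" "y \<in> {b..b + h}"
    and A: "g (a + h, b + h) - g (a + h, b) - g (a, b + h) + g (a, b) = h * h * ?A (x, y)"
    using second_difference_mean_value[of h a b "\<lambda>x y. g (x, y)" "\<lambda>x y. partial_x g (x, y)"
        "\<lambda>x y. ?A (x, y)"] h in_S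
      has_real_derivative_partial_x[OF assms(2)] has_real_derivative_partial_y[OF gx] by metis
  obtain y' x' where yx: "y' \<in> {b..b + h}" "x' \<in> {a..a + h}"
    and B: "g (a + h, b + h) - g (a, b + h) - g (a + h, b) + g (a, b) = h * h * ?B (x', y')"
    using second_difference_mean_value[of h b a "\<lambda>y x. g (x, y)" "\<lambda>y x. partial_y g (x, y)"
        "\<lambda>y x. ?B (x, y)"] h in_S
      has_real_derivative_partial_y[OF assms(2)] has_real_derivative_partial_x[OF gy] by metis
  have "h * h * ?A (x, y) = h * h * ?B (x', y')"
    using A B by linarith
  then have "?A (x, y) = ?B (x', y')" using h by simp
  moreover have "\<bar>?A (x, y) - ?A p\<bar> < e" "\<bar>?B (x', y') - ?B p\<bar> < e"
    using near[OF square[OF xy]] near[OF square[OF yx(2,1)]] by (auto simp: dist_real_def)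
  ultimately have "\<bar>?A p - ?B p\<bar> < 2 * e"
    by linarith
  then show False by (simp add: e_def)
qed

lemma partial_y_funpow_partial_x:
  assumes "open S" "C_diff (Suc i) S g" "p \<in> S"
  shows "partial_y ((partial_x ^^ i) g) p = (partial_x ^^ i) (partial_y g) p"
  using assms(2,3)
proof (induction i arbitrary: g p)
  case (Suc i)
  have "partial_y ((partial_x ^^ Suc i) g) p = (partial_x ^^ i) (partial_y (partial_x g)) p"
    using Suc.IH[OF C_diff_partial_x[OF Suc.prems(1)] Suc.prems(2)] by (simp add: funpow_swap1)
  also have "\<dots> = (partial_x ^^ i) (partial_x (partial_y g)) p"
    using partial_y_partial_x[OF assms(1) Suc.prems(1)] Suc.prems(2)
    by (intro derivation_on.funpow_cong[OF derivation_on_partial_x[OF assms(1)]])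
  finally show ?case by (simp add: funpow_swap1)
qed simp

lemma funpow_partial_y_funpow_partial_x:
  assumes "open S" "C_diff (i + j) S g" "p \<in> S"
  shows "(partial_y ^^ j) ((partial_x ^^ i) g) p = mixed_partial i j g p"
  unfolding mixed_partial_def using assms(2,3)
proof (induction j arbitrary: g p)
  case (Suc j)
  have Si: "C_diff (Suc i) S g"
    using Suc.prems(1) by (rule C_diff_mono) simp
  have "(partial_y ^^ Suc j) ((partial_x ^^ i) g) p =
      (partial_y ^^ j) (partial_y ((partial_x ^^ i) g)) p"
    by (simp add: funpow_swap1)
  also have "\<dots> = (partial_y ^^ j) ((partial_x ^^ i) (partial_y g)) p"
    using partial_y_funpow_partial_x[OF assms(1) Si] Suc.prems(2)
    by (intro derivation_on.funpow_cong[OF derivation_on_partial_y[OF assms(1)]])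
  also have "\<dots> = (partial_x ^^ i) ((partial_y ^^ j) (partial_y g)) p"
    using Suc.prems by (intro Suc.IH C_diff_partial_y) auto
  finally show ?case by (simp add: funpow_swap1)
qed simp

section \<open>The identity in two variables\<close>

theorem theorem3:
  fixes \<Omega> :: "(real \<times> real) set"
    and m n :: nat
    and f u :: "real \<times> real \<Rightarrow> real"
  assumes "open \<Omega>" and "connected \<Omega>" and "bounded \<Omega>"
    and "C_diff (m + n) \<Omega> f"
    and "C_diff (m + n) \<Omega> u"
  shows "\<forall>p\<in>\<Omega>. f p * mixed_partial m n u p =
    (\<Sum>i=0..m. \<Sum>j=0..n. (-1) ^ (i + j) * real (m choose i) * real (n choose j) *
       mixed_partial (m - i) (n - j) (\<lambda>q. mixed_partial i j f q * u q) p)"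
proof
  fix p assume p: "p \<in> \<Omega>"
  interpret X: derivation_on \<Omega> partial_x by (rule derivation_on_partial_x) fact
  interpret Y: derivation_on \<Omega> partial_y by (rule derivation_on_partial_y) fact
  define P where "P i j = (partial_y ^^ (n - j)) (\<lambda>q. mixed_partial i j f q * u q)" for i j
  (* D_x^i D_y^j f costs i + j of the m + n derivatives, and the outer D_y^(n - j) costs n - j more;
     the m - i that remain are those still to be taken in x. *)
  have C_diff_P: "C_diff (m - i) \<Omega> (P i j)" if "i \<le> m" "j \<le> n" for i j
  proof -
    have "C_diff ((m - i) + (n - j)) \<Omega> (mixed_partial i j f)"
      unfolding mixed_partial_def using that assms(4)
      by (intro X.C_diff_funpow Y.C_diff_funpow) (simp add: algebra_simps)
    moreover have "C_diff ((m - i) + (n - j)) \<Omega> u"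
      using assms(5) by (rule C_diff_mono) simp
    ultimately show ?thesis
      unfolding P_def by (intro Y.C_diff_funpow C_diff_mult[OF assms(1)])
  qed
  (* The rearranged y-identity applies to D_x^i f because i \<le> m leaves it n derivatives; Schwarz's
     theorem restores the order D_x^i D_y^j. *)
  have inner: "(partial_x ^^ i) f q * (partial_y ^^ n) u q =
      (\<Sum>j\<le>n. (-1) ^ j * real (n choose j) * P i j q)" if "i \<le> m" "q \<in> \<Omega>" for i q
  proof -
    have "C_diff n \<Omega> ((partial_x ^^ i) f)"
      using that assms(4) by (intro X.C_diff_funpow) (auto intro: C_diff_mono)
    moreover have "C_diff n \<Omega> u"
      using assms(5) by (rule C_diff_mono) simp
    ultimately have "(partial_x ^^ i) f q * (partial_y ^^ n) u q =
        (\<Sum>j\<le>n. (-1) ^ j * real (n choose j) *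
          (partial_y ^^ (n - j)) (\<lambda>r. (partial_y ^^ j) ((partial_x ^^ i) f) r * u r) q)"
      using that(2) by (rule Y.times_iterated_derivative)
    also have "\<dots> = (\<Sum>j\<le>n. (-1) ^ j * real (n choose j) * P i j q)"
    proof (rule sum.cong)
      fix j assume "j \<in> {..n}"
      then have "C_diff (i + j) \<Omega> f"
        using that(1) assms(4) by (auto intro: C_diff_mono)
      then have "(partial_y ^^ (n - j)) (\<lambda>r. (partial_y ^^ j) ((partial_x ^^ i) f) r * u r) q = P i j q"
        unfolding P_def
        by (intro Y.funpow_cong that(2)) (simp add: funpow_partial_y_funpow_partial_x[OF assms(1)])
      then show "(-1) ^ j * real (n choose j) *
          (partial_y ^^ (n - j)) (\<lambda>r. (partial_y ^^ j) ((partial_x ^^ i) f) r * u r) q =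
          (-1) ^ j * real (n choose j) * P i j q"
        by simp
    qed simp
    finally show ?thesis .
  qed
  have "C_diff m \<Omega> f" "C_diff m \<Omega> ((partial_y ^^ n) u)"
    using assms(4,5) by (auto intro: C_diff_mono Y.C_diff_funpow)
  then have "f p * mixed_partial m n u p = (\<Sum>i\<le>m. (-1) ^ i * real (m choose i) *
      (partial_x ^^ (m - i)) (\<lambda>q. (partial_x ^^ i) f q * (partial_y ^^ n) u q) p)"
    unfolding mixed_partial_def using p by (rule X.times_iterated_derivative)
  also have "\<dots> = (\<Sum>i\<le>m. (-1) ^ i * real (m choose i) *
      (\<Sum>j\<le>n. (-1) ^ j * real (n choose j) * (partial_x ^^ (m - i)) (P i j) p))"
  proof (rule sum.cong)
    fix i assume "i \<in> {..m}"
    then have i: "i \<le> m" by simp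
    have "(partial_x ^^ (m - i)) (\<lambda>q. (partial_x ^^ i) f q * (partial_y ^^ n) u q) p =
        (partial_x ^^ (m - i)) (\<lambda>q. \<Sum>j\<le>n. (-1) ^ j * real (n choose j) * P i j q) p"
      using inner[OF i] p by (rule X.funpow_cong)
    also have "\<dots> = (\<Sum>j\<le>n. (-1) ^ j * real (n choose j) * (partial_x ^^ (m - i)) (P i j) p)"
      using C_diff_P[OF i] p by (intro X.funpow_sum) auto
    finally show "(-1) ^ i * real (m choose i) *
        (partial_x ^^ (m - i)) (\<lambda>q. (partial_x ^^ i) f q * (partial_y ^^ n) u q) p =
        (-1) ^ i * real (m choose i) *
        (\<Sum>j\<le>n. (-1) ^ j * real (n choose j) * (partial_x ^^ (m - i)) (P i j) p)"
      by simp
  qed simp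
  also have "\<dots> = (\<Sum>i=0..m. \<Sum>j=0..n. (-1) ^ (i + j) * real (m choose i) * real (n choose j) *
      mixed_partial (m - i) (n - j) (\<lambda>q. mixed_partial i j f q * u q) p)"
    by (simp add: P_def mixed_partial_def[of "m - _" "n - _"] sum_distrib_left power_add
        atMost_atLeast0 mult.assoc mult.left_commute)
  finally show "f p * mixed_partial m n u p =
    (\<Sum>i=0..m. \<Sum>j=0..n. (-1) ^ (i + j) * real (m choose i) * real (n choose j) *
       mixed_partial (m - i) (n - j) (\<lambda>q. mixed_partial i j f q * u q) p)" .
qed

end
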